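(* Let $f:X\to Y$ be a map of bisimplicial sets such that the induced map of diagonal simplicial sets $\operatorname{diag} f:\operatorname{diag} X\to \operatorname{diag} Y$ is a Kan fibration. Then, for each integer $p\geq 0$, the simplicial map $f_{p,*}:X_{p,*}\to Y_{p,*}$ is a Kan fibration.
   Context: $\Delta$ denotes the category of the finite ordered sets $[n]=\{0,1,\ldots,n\}$, $n\geq 0$, with weakly order-preserving maps. A simplicial set is a functor $\Delta^{op}\to\mathrm{Set}$. A bisimplicial set is a functor $X:\Delta^{op}\times\Delta^{op}\to\mathrm{Set}$, $([p],[q])\mapsto X_{p,q}$, and a bisimplicial map is a natural transformation of such functors. For a bisimplicial set $X$ and fixed $p\geq 0$, $X_{p,*}$ is the simplicial set $[q]\mapsto X_{p,q}$, and $f_{p,*}$ is the simplicial map with components $f_{p,q}:X_{p,q}\to Y_{p,q}$, $q\geq 0$. The diagonal $\operatorname{diag}X$ is the simplicial set $[n]\mapsto X_{n,n}$, obtained by composing $X$ with the diagonal functor $\Delta^{op}\to\Delta^{op}\times\Delta^{op}$, and $\operatorname{diag} f$ is the simplicial map with components $f_{n,n}$. A simplicial map $g:A\to B$ is a Kan fibration if for all $n\geq 1$, all $0\leq k\leq n$, and all simplices $x_0,\ldots,x_{k-1},x_{k+1},\ldots,x_n\in A_{n-1}$ and $y\in B_n$ such that $d_ix_j=d_{j-1}x_i$ for all $i<j$ with $i\neq k\neq j$ and $d_iy=g(x_i)$ for all $i\neq k$, there is a simplex $x\in A_n$ with $d_ix=x_i$ for all $i\neq k$ and $g(x)=y$.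 *)

theory Defs
  imports Main "HOL-Library.FuncSet"
begin

text \<open>
  The morphisms \<open>[m] \<rightarrow> [n]\<close> of the simplex category are represented by extensional functions on
  \<open>{..m}\<close>, so that equality of HOL functions is equality of morphisms. Such a function does not
  determine its codomain, which is why the structure maps below take the source and the target of
  a morphism as separate arguments.
\<close>

definition delta_hom :: "nat \<Rightarrow> nat \<Rightarrow> (nat \<Rightarrow> nat) set" where
  "delta_hom m n = {\<alpha> \<in> {..m} \<rightarrow>\<^sub>E {..n}. mono_on {..m} \<alpha>}"

definition delta_id :: "nat \<Rightarrow> nat \<Rightarrow> nat" where
  "delta_id n = (\<lambda>j\<in>{..n}. j)"

text \<open>The injection \<open>[n - 1] \<rightarrow> [n]\<close> that omits \<open>i\<close>; only used for \<open>n \<ge> 1\<close> and \<open>i \<le> n\<close>.\<close>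

definition coface :: "nat \<Rightarrow> nat \<Rightarrow> nat \<Rightarrow> nat" where
  "coface n i = (\<lambda>j\<in>{..n - 1}. if j < i then j else j + 1)"

text \<open>
  The sets of simplices in the various degrees are subsets of one type; they need not be disjoint.
  For \<open>\<alpha> \<in> delta_hom m n\<close>, the term \<open>act A m n \<alpha>\<close> is the contravariantly induced map from
  \<open>simplices A n\<close> to \<open>simplices A m\<close>. Its values outside \<open>simplices A n\<close> are irrelevant.
\<close>

record 'a sset =
  simplices :: "nat \<Rightarrow> 'a set"
  act :: "nat \<Rightarrow> nat \<Rightarrow> (nat \<Rightarrow> nat) \<Rightarrow> 'a \<Rightarrow> 'a"

definition simplicial_set :: "'a sset \<Rightarrow> bool" where
  "simplicial_set A \<longleftrightarrow>
     (\<forall>m n. \<forall>\<alpha>\<in>delta_hom m n. act A m n \<alpha> \<in> simplices A n \<rightarrow> simplices A m) \<and>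
     (\<forall>n. \<forall>x\<in>simplices A n. act A n n (delta_id n) x = x) \<and>
     (\<forall>l m n. \<forall>\<alpha>\<in>delta_hom l m. \<forall>\<beta>\<in>delta_hom m n. \<forall>x\<in>simplices A n.
        act A l n (compose {..l} \<beta> \<alpha>) x = act A l m \<alpha> (act A m n \<beta> x))"

definition simplicial_map :: "'a sset \<Rightarrow> 'b sset \<Rightarrow> (nat \<Rightarrow> 'a \<Rightarrow> 'b) \<Rightarrow> bool" where
  "simplicial_map A B g \<longleftrightarrow>
     simplicial_set A \<and> simplicial_set B \<and>
     (\<forall>n. g n \<in> simplices A n \<rightarrow> simplices B n) \<and>
     (\<forall>m n. \<forall>\<alpha>\<in>delta_hom m n. \<forall>x\<in>simplices A n.
        g m (act A m n \<alpha> x) = act B m n \<alpha> (g n x))"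

text \<open>\<open>face A n i\<close> is \<open>d\<^sub>i\<close> from degree \<open>n\<close> to degree \<open>n - 1\<close>.\<close>

definition face :: "'a sset \<Rightarrow> nat \<Rightarrow> nat \<Rightarrow> 'a \<Rightarrow> 'a" where
  "face A n i = act A (n - 1) n (coface n i)"

text \<open>
  For \<open>n = 1\<close> the compatibility condition is vacuous, so the meaningless operator \<open>face A 0 i\<close>
  plays no role. The value \<open>x k\<close> of the family of simplices is unconstrained.
\<close>

definition kan_fibration :: "'a sset \<Rightarrow> 'b sset \<Rightarrow> (nat \<Rightarrow> 'a \<Rightarrow> 'b) \<Rightarrow> bool" where
  "kan_fibration A B g \<longleftrightarrow>
     simplicial_map A B g \<and>
     (\<forall>n\<ge>1. \<forall>k\<le>n. \<forall>x. \<forall>y\<in>simplices B n.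
        (\<forall>i\<le>n. i \<noteq> k \<longrightarrow> x i \<in> simplices A (n - 1)) \<longrightarrow>
        (\<forall>i j. i < j \<and> j \<le> n \<and> i \<noteq> k \<and> j \<noteq> k \<longrightarrow>
           face A (n - 1) i (x j) = face A (n - 1) (j - 1) (x i)) \<longrightarrow>
        (\<forall>i\<le>n. i \<noteq> k \<longrightarrow> face B n i y = g (n - 1) (x i)) \<longrightarrow>
        (\<exists>z\<in>simplices A n. (\<forall>i\<le>n. i \<noteq> k \<longrightarrow> face A n i z = x i) \<and> g n z = y))"

text \<open>
  For \<open>\<alpha> \<in> delta_hom p p'\<close> and \<open>\<beta> \<in> delta_hom q q'\<close>, the term \<open>biact X p p' \<alpha> q q' \<beta>\<close> is the
  induced map from \<open>bisimplices X p' q'\<close> to \<open>bisimplices X p q\<close>.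
\<close>

record 'a bisset =
  bisimplices :: "nat \<Rightarrow> nat \<Rightarrow> 'a set"
  biact :: "nat \<Rightarrow> nat \<Rightarrow> (nat \<Rightarrow> nat) \<Rightarrow> nat \<Rightarrow> nat \<Rightarrow> (nat \<Rightarrow> nat) \<Rightarrow> 'a \<Rightarrow> 'a"

definition bisimplicial_set :: "'a bisset \<Rightarrow> bool" where
  "bisimplicial_set X \<longleftrightarrow>
     (\<forall>p p' q q'. \<forall>\<alpha>\<in>delta_hom p p'. \<forall>\<beta>\<in>delta_hom q q'.
        biact X p p' \<alpha> q q' \<beta> \<in> bisimplices X p' q' \<rightarrow> bisimplices X p q) \<and>
     (\<forall>p q. \<forall>x\<in>bisimplices X p q. biact X p p (delta_id p) q q (delta_id q) x = x) \<and>
     (\<forall>p p' p'' q q' q''.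
        \<forall>\<alpha>\<in>delta_hom p p'. \<forall>\<alpha>'\<in>delta_hom p' p''. \<forall>\<beta>\<in>delta_hom q q'. \<forall>\<beta>'\<in>delta_hom q' q''.
        \<forall>x\<in>bisimplices X p'' q''.
          biact X p p'' (compose {..p} \<alpha>' \<alpha>) q q'' (compose {..q} \<beta>' \<beta>) x =
          biact X p p' \<alpha> q q' \<beta> (biact X p' p'' \<alpha>' q' q'' \<beta>' x))"

definition bisimplicial_map :: "'a bisset \<Rightarrow> 'b bisset \<Rightarrow> (nat \<Rightarrow> nat \<Rightarrow> 'a \<Rightarrow> 'b) \<Rightarrow> bool" where
  "bisimplicial_map X Y f \<longleftrightarrow>
     bisimplicial_set X \<and> bisimplicial_set Y \<and>
     (\<forall>p q. f p q \<in> bisimplices X p q \<rightarrow> bisimplices Y p q) \<and>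
     (\<forall>p p' q q'. \<forall>\<alpha>\<in>delta_hom p p'. \<forall>\<beta>\<in>delta_hom q q'. \<forall>x\<in>bisimplices X p' q'.
        f p q (biact X p p' \<alpha> q q' \<beta> x) = biact Y p p' \<alpha> q q' \<beta> (f p' q' x))"

definition row :: "'a bisset \<Rightarrow> nat \<Rightarrow> 'a sset" where
  "row X p = \<lparr>simplices = bisimplices X p, act = biact X p p (delta_id p)\<rparr>"

definition row_map :: "(nat \<Rightarrow> nat \<Rightarrow> 'a \<Rightarrow> 'b) \<Rightarrow> nat \<Rightarrow> nat \<Rightarrow> 'a \<Rightarrow> 'b" where
  "row_map f p = (\<lambda>q. f p q)"

definition diag :: "'a bisset \<Rightarrow> 'a sset" where
  "diag X = \<lparr>simplices = (\<lambda>n. bisimplices X n n), act = (\<lambda>m n \<alpha>. biact X m n \<alpha> m n \<alpha>)\<rparr>"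

definition diag_map :: "(nat \<Rightarrow> nat \<Rightarrow> 'a \<Rightarrow> 'b) \<Rightarrow> nat \<Rightarrow> 'a \<Rightarrow> 'b" where
  "diag_map f = (\<lambda>n. f n n)"

lemma delta_id_in_delta_hom: "delta_id n \<in> delta_hom n n"
  by (auto simp: delta_hom_def delta_id_def mono_on_def)

lemma coface_in_delta_hom: "n \<ge> 1 \<Longrightarrow> coface n i \<in> delta_hom (n - 1) n"
  by (auto simp: delta_hom_def coface_def mono_on_def)

lemma compose_in_delta_hom:
  assumes "\<alpha> \<in> delta_hom l m" and "\<beta> \<in> delta_hom m n"
  shows "compose {..l} \<beta> \<alpha> \<in> delta_hom l n"
  using assms by (auto simp: delta_hom_def mono_on_def compose_def PiE_iff)

lemma compose_delta_id: "compose {..n} (delta_id n) (delta_id n) = delta_id n"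
  by (auto simp: delta_id_def compose_def fun_eq_iff)

lemma simplicial_set_diag:
  assumes "bisimplicial_set X"
  shows "simplicial_set (diag X)"
  using assms unfolding bisimplicial_set_def simplicial_set_def diag_def by simp

lemma simplicial_set_row:
  assumes "bisimplicial_set X"
  shows "simplicial_set (row X p)"
proof -
  have "biact X p p (delta_id p) l n (compose {..l} \<beta> \<alpha>) x =
      biact X p p (delta_id p) l m \<alpha> (biact X p p (delta_id p) m n \<beta> x)"
    if "\<alpha> \<in> delta_hom l m" "\<beta> \<in> delta_hom m n" "x \<in> bisimplices X p n" for l m n \<alpha> \<beta> x
    using assms that delta_id_in_delta_hom[of p] compose_delta_id[of p]
    unfolding bisimplicial_set_def by metis
  then show ?thesis
    using assms delta_id_in_delta_hom[of p]
    unfolding bisimplicial_set_def simplicial_set_def row_def by simp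
qed

lemma simplicial_map_diag_map:
  assumes "bisimplicial_map X Y f"
  shows "simplicial_map (diag X) (diag Y) (diag_map f)"
  using assms simplicial_set_diag[of X] simplicial_set_diag[of Y]
  unfolding bisimplicial_map_def simplicial_map_def by (simp add: diag_def diag_map_def)

lemma simplicial_map_row_map:
  assumes "bisimplicial_map X Y f"
  shows "simplicial_map (row X p) (row Y p) (row_map f p)"
  using assms simplicial_set_row[of X p] simplicial_set_row[of Y p] delta_id_in_delta_hom[of p]
  unfolding bisimplicial_map_def simplicial_map_def by (simp add: row_def row_map_def)

end

theory Submission
  imports Defs
begin

text \<open>
  Composing a bisimplex of bidegree \<open>(p, n)\<close> with surjections \<open>[n + p] \<rightarrow> [p]\<close> and \<open>[n + p] \<rightarrow> [n]\<close>
  turns it into a simplex of the diagonal, from which sections of the two surjections recover it.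
  A horn in \<open>X\<^bsub>p,*\<^esub>\<close> without \<open>k\<close>-th face can therefore be filled in \<open>diag X\<close>, provided that the
  two passages can be made compatible with all the faces \<open>d\<^sub>i\<close>, \<open>i \<noteq> k\<close>.

  This compatibility dictates the choice of the surjections. Let \<open>\<beta> : [n + p] \<rightarrow> [n]\<close> collapse the
  block \<open>{k..k + p}\<close> to \<open>k\<close> and be injective elsewhere. Then the restriction of a diagonal simplex
  to the \<open>i\<close>-th face of the second coordinate can be read off from the facet of \<open>[n + p]\<close> opposite
  to the single vertex in \<open>\<beta>\<^sup>-\<^sup>1(i)\<close>, as soon as the section \<open>[p] \<rightarrow> [n + p]\<close> used in the first
  coordinate avoids that vertex. It avoids these vertices for all \<open>i \<noteq> k\<close> at once exactly if its
  image is the block; this is why the block has \<open>p + 1\<close> elements, and it determines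
  \<open>[n + p] \<rightarrow> [p]\<close> as well. The maps \<open>expand\<close> and \<open>contract\<close> are the resulting passages, and
  \<open>expand_face\<close> and \<open>face_contract\<close> express their compatibility with faces.

  Under \<open>expand\<close>, a horn without \<open>k\<close>-th face becomes a compatible family of facets of an
  \<open>(n + p)\<close>-simplex in which precisely the facets with index in the block are missing. Kan
  fibrations lift such horns as well (\<open>kan_fibration_lifts_consecutive_horn\<close>): the last missing
  facet is itself a filler of a horn that misses one consecutive facet fewer, so the missing
  facets can be supplied one by one until an ordinary horn is left.
\<close>

section \<open>Horns with consecutive missing facets\<close>

lemma face_in_simplices:
  assumes "simplicial_set A" and "x \<in> simplices A n" and "n \<ge> 1"
  shows "face A n i x \<in> simplices A (n - 1)"
  using assms coface_in_delta_hom[of n i] unfolding simplicial_set_def face_def by blast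

lemma coface_coface:
  assumes "i < j" and "n \<ge> 2"
  shows "compose {..n - 2} (coface n j) (coface (n - 1) i)
       = compose {..n - 2} (coface n i) (coface (n - 1) (j - 1))"
  using assms by (auto simp: compose_def coface_def fun_eq_iff)

lemma face_face:
  assumes A: "simplicial_set A" and x: "x \<in> simplices A n" and "i < j" and n: "n \<ge> 2"
  shows "face A (n - 1) i (face A n j x) = face A (n - 1) (j - 1) (face A n i x)"
proof -
  have *: "act A (n - 2) n (compose {..n - 2} (coface n b) (coface (n - 1) a)) x
      = face A (n - 1) a (face A n b x)" for a b
  proof -
    have "coface (n - 1) a \<in> delta_hom (n - 2) (n - 1)" "coface n b \<in> delta_hom (n - 1) n"
      using coface_in_delta_hom[of "n - 1" a] coface_in_delta_hom[of n b] n
      by (simp_all add: numeral_2_eq_2)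
    then have "act A (n - 2) n (compose {..n - 2} (coface n b) (coface (n - 1) a)) x
      = act A (n - 2) (n - 1) (coface (n - 1) a) (act A (n - 1) n (coface n b) x)"
      using A x unfolding simplicial_set_def by blast
    then show ?thesis
      by (simp add: face_def numeral_2_eq_2)
  qed
  show ?thesis
    using *[of j i] *[of i "j - 1"] coface_coface[OF \<open>i < j\<close> n] by simp
qed

lemma simplicial_map_face:
  assumes "simplicial_map A B g" and "x \<in> simplices A n" and "n \<ge> 1"
  shows "g (n - 1) (face A n i x) = face B n i (g n x)"
  using assms coface_in_delta_hom[of n i] unfolding simplicial_map_def face_def by blast

text \<open>
  The condition \<open>p < n\<close> says that at least one of the \<open>n + 1\<close> facets is given; without it the
  lemma would assert that the fibration is surjective on \<open>n\<close>-simplices. In the induction step, let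
  \<open>j = k + p + 1\<close> be the last missing index. The given facets intersect the \<open>j\<close>-th one in a horn
  of dimension \<open>n - 1\<close> with missing faces \<open>k..k + p\<close>. A filler of it over \<open>d\<^sub>j y\<close> serves as
  \<open>j\<close>-th facet, and what remains is a horn of dimension \<open>n\<close> with missing faces \<open>k..k + p\<close>.
  The first horn has a given face again because \<open>n\<close> and the number of missing faces both drop by one.
\<close>

lemma kan_fibration_lifts_consecutive_horn:
  assumes "kan_fibration A B g"
    and "p < n" and "k + p \<le> n"
    and "y \<in> simplices B n"
    and "\<And>i. i \<le> n \<Longrightarrow> i \<notin> {k..k + p} \<Longrightarrow> x i \<in> simplices A (n - 1)"
    and "\<And>i j. i < j \<Longrightarrow> j \<le> n \<Longrightarrow> i \<notin> {k..k + p} \<Longrightarrow> j \<notin> {k..k + p} \<Longrightarrow>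
           face A (n - 1) i (x j) = face A (n - 1) (j - 1) (x i)"
    and "\<And>i. i \<le> n \<Longrightarrow> i \<notin> {k..k + p} \<Longrightarrow> face B n i y = g (n - 1) (x i)"
  shows "\<exists>z\<in>simplices A n. (\<forall>i\<le>n. i \<notin> {k..k + p} \<longrightarrow> face A n i z = x i) \<and> g n z = y"
  using assms(2-)
proof (induction p arbitrary: n x y)
  case 0
  then show ?case
    using assms(1) unfolding kan_fibration_def by simp
next
  case (Suc p)
  have g: "simplicial_map A B g" and A: "simplicial_set A" and B: "simplicial_set B"
    using assms(1) unfolding kan_fibration_def simplicial_map_def by auto
  define j where "j = k + Suc p"
  have n: "n \<ge> 2" and j: "j \<le> n" "j \<ge> 1" "k < j"
    using Suc.prems(1,2) by (auto simp: j_def)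
  have out: "i \<notin> {k..k + Suc p} \<longleftrightarrow> i < k \<or> j < i" for i
    by (auto simp: j_def)
  have out': "i \<notin> {k..k + p} \<longleftrightarrow> i < k \<or> j \<le> i" for i
    by (auto simp: j_def)
  note x = Suc.prems(4)[unfolded out]
    and comm = Suc.prems(5)[unfolded out]
    and gx = Suc.prems(6)[unfolded out]
  (* The faces that the missing facet j must have. By the simplicial identities, its i-th face is
     the (j - 1)-st face of facet i if i < j, and the j-th face of facet i + 1 if i >= j. *)
  define x' where "x' i = (if i < k then face A (n - 1) (j - 1) (x i)
      else face A (n - 1) j (x (i + 1)))" for i
  have "\<exists>w\<in>simplices A (n - 1). (\<forall>i\<le>n - 1. i \<notin> {k..k + p} \<longrightarrow> face A (n - 1) i w = x' i)
      \<and> g (n - 1) w = face B n j y"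
  proof (rule Suc.IH, unfold out')
    show "p < n - 1" "k + p \<le> n - 1"
      using Suc.prems(1,2) by auto
    show "face B n j y \<in> simplices B (n - 1)"
      using face_in_simplices[OF B Suc.prems(3)] n by simp
  next
    fix i assume i: "i \<le> n - 1" "i < k \<or> j \<le> i"
    show "x' i \<in> simplices A (n - 1 - 1)"
      using i n j face_in_simplices[OF A x[of i], of "j - 1"]
        face_in_simplices[OF A x[of "i + 1"], of j]
      unfolding x'_def by auto
    have "face B (n - 1) i (face B n j y) = face B (n - 1) (j - 1) (face B n i y)" if "i < k"
      using face_face[OF B Suc.prems(3) _ n, of i j] that j by simp
    moreover have "face B (n - 1) i (face B n j y) = face B (n - 1) j (face B n (i + 1) y)" if "j \<le> i"
      using face_face[OF B Suc.prems(3) _ n, of j "i + 1"] that by simp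
    ultimately show "face B (n - 1) i (face B n j y) = g (n - 1 - 1) (x' i)"
      using i n j x[of i] x[of "i + 1"] gx[of i] gx[of "i + 1"]
        simplicial_map_face[OF g x[of i], of "j - 1"]
        simplicial_map_face[OF g x[of "i + 1"], of j]
      unfolding x'_def by auto
  next
    fix i l assume il: "i < l" "l \<le> n - 1" "i < k \<or> j \<le> i" "l < k \<or> j \<le> l"
    have n3: "n - 1 \<ge> 2"
      using il j by linarith
    note ff = face_face[OF A _ _ n3]
    consider "l < k" | "i < k" "j \<le> l" | "j \<le> i"
      using il by linarith
    then show "face A (n - 1 - 1) i (x' l) = face A (n - 1 - 1) (l - 1) (x' i)"
    proof cases
      case 1
      then have "face A (n - 1 - 1) i (face A (n - 1) (j - 1) (x l))
          = face A (n - 1 - 1) (j - 1 - 1) (face A (n - 1) i (x l))"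
        using il j n by (intro ff x) auto
      also have "\<dots> = face A (n - 1 - 1) (j - 1 - 1) (face A (n - 1) (l - 1) (x i))"
        using 1 il j n by (subst comm[of i l]) auto
      also have "\<dots> = face A (n - 1 - 1) (l - 1) (face A (n - 1) (j - 1) (x i))"
        using 1 il j n by (intro ff[symmetric] x) auto
      finally show ?thesis
        using 1 il by (simp add: x'_def)
    next
      case 2
      then have "face A (n - 1 - 1) i (face A (n - 1) j (x (l + 1)))
          = face A (n - 1 - 1) (j - 1) (face A (n - 1) i (x (l + 1)))"
        using il j n by (intro ff x) auto
      also have "\<dots> = face A (n - 1 - 1) (j - 1) (face A (n - 1) l (x i))"
        using 2 il j n by (subst comm[of i "l + 1"]) auto
      also have "\<dots> = face A (n - 1 - 1) (l - 1) (face A (n - 1) (j - 1) (x i))"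
        using 2 il j n by (intro ff x) auto
      finally show ?thesis
        using 2 j by (simp add: x'_def)
    next
      case 3
      then have "face A (n - 1 - 1) i (face A (n - 1) j (x (l + 1)))
          = face A (n - 1 - 1) j (face A (n - 1) (i + 1) (x (l + 1)))"
        using ff[of "x (l + 1)" j "i + 1"] x[of "l + 1"] il j n by simp
      also have "\<dots> = face A (n - 1 - 1) j (face A (n - 1) l (x (i + 1)))"
        using 3 il j n by (subst comm[of "i + 1" "l + 1"]) auto
      also have "\<dots> = face A (n - 1 - 1) (l - 1) (face A (n - 1) j (x (i + 1)))"
        using 3 il j n by (intro ff x) auto
      finally show ?thesis
        using 3 il j by (simp add: x'_def)
    qed
  qed
  then obtain w where w: "w \<in> simplices A (n - 1)" "g (n - 1) w = face B n j y"
    and wf: "\<And>i. i \<le> n - 1 \<Longrightarrow> i < k \<or> j \<le> i \<Longrightarrow> face A (n - 1) i w = x' i"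
    unfolding out' by blast
  have "\<exists>z\<in>simplices A n. (\<forall>i\<le>n. i \<notin> {k..k + p} \<longrightarrow> face A n i z = (x(j := w)) i) \<and> g n z = y"
  proof (rule Suc.IH, unfold out')
    show "p < n" "k + p \<le> n" "y \<in> simplices B n"
      using Suc.prems(1-3) by auto
    show "(x(j := w)) i \<in> simplices A (n - 1)" "face B n i y = g (n - 1) ((x(j := w)) i)"
      if "i \<le> n" "i < k \<or> j \<le> i" for i
      using that x[of i] gx[of i] w by auto
    show "face A (n - 1) i ((x(j := w)) l) = face A (n - 1) (l - 1) ((x(j := w)) i)"
      if "i < l" "l \<le> n" "i < k \<or> j \<le> i" "l < k \<or> j \<le> l" for i l
    proof -
      consider "l = j" | "i = j" | "l \<noteq> j" "i \<noteq> j" by blast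
      then show ?thesis
      proof cases
        case 1
        then show ?thesis
          using that j wf[of i] by (auto simp: x'_def)
      next
        case 2
        then have "l - 1 \<le> n - 1" "\<not> l - 1 < k" "j \<le> l - 1" "l - 1 + 1 = l"
          using that j by auto
        then show ?thesis
          using 2 that wf[of "l - 1"] by (simp add: x'_def)
      next
        case 3
        then show ?thesis
          using that comm[of i l] by auto
      qed
    qed
  qed
  then obtain z where "z \<in> simplices A n" "g n z = y"
    and zf: "\<And>i. i \<le> n \<Longrightarrow> i < k \<or> j \<le> i \<Longrightarrow> face A n i z = (x(j := w)) i"
    unfolding out' by blast
  moreover have "face A n i z = x i" if "i \<le> n" "i < k \<or> j < i" for i
    using zf[of i] that j by auto
  ultimately show ?case
    unfolding out by blast
qed

section \<open>Rows as retracts of the diagonal\<close>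

text \<open>
  The following four maps concern the block \<open>{k..k + p}\<close> of \<open>p + 1\<close> vertices of \<open>[n + p]\<close>. The
  coordinate within the block is extended to all of \<open>[n + p]\<close> by the constants \<open>0\<close> below and \<open>p\<close>
  above. The section \<open>skip_block\<close> has to hit some vertex of the block over \<open>k\<close>, for which the
  first one is taken.
\<close>

definition block_coordinate :: "nat \<Rightarrow> nat \<Rightarrow> nat \<Rightarrow> nat \<Rightarrow> nat" where
  "block_coordinate p n k = (\<lambda>v\<in>{..n + p}. min (v - k) p)"

definition collapse_block :: "nat \<Rightarrow> nat \<Rightarrow> nat \<Rightarrow> nat \<Rightarrow> nat" where
  "collapse_block p n k = (\<lambda>v\<in>{..n + p}. if v \<le> k then v else max k (v - p))"

definition include_block :: "nat \<Rightarrow> nat \<Rightarrow> nat \<Rightarrow> nat" where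
  "include_block p k = (\<lambda>v\<in>{..p}. k + v)"

definition skip_block :: "nat \<Rightarrow> nat \<Rightarrow> nat \<Rightarrow> nat \<Rightarrow> nat" where
  "skip_block p n k = (\<lambda>v\<in>{..n}. if v \<le> k then v else v + p)"

lemma block_maps_in_delta_hom:
  assumes "k \<le> n"
  shows "block_coordinate p n k \<in> delta_hom (n + p) p"
    and "collapse_block p n k \<in> delta_hom (n + p) n"
    and "include_block p k \<in> delta_hom p (n + p)"
    and "skip_block p n k \<in> delta_hom n (n + p)"
  using assms
  by (auto simp: delta_hom_def mono_on_def block_coordinate_def collapse_block_def
      include_block_def skip_block_def)

lemma block_sections:
  assumes "k \<le> n"
  shows "compose {..p} (block_coordinate p n k) (include_block p k) = delta_id p"
    and "compose {..n} (collapse_block p n k) (skip_block p n k) = delta_id n"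
  using assms
  by (auto simp: compose_def fun_eq_iff block_coordinate_def collapse_block_def
      include_block_def skip_block_def delta_id_def)

text \<open>
  For \<open>i \<noteq> k\<close>, \<open>facet_index p k i\<close> is the vertex of \<open>[n + p]\<close> over \<open>i\<close>. Removing it, and \<open>i\<close>
  from \<open>[n]\<close>, leaves a collapse of the same kind, whose block starts at \<open>block_start k i\<close>.
\<close>

definition facet_index :: "nat \<Rightarrow> nat \<Rightarrow> nat \<Rightarrow> nat" where
  "facet_index p k i = (if i < k then i else i + p)"

definition block_start :: "nat \<Rightarrow> nat \<Rightarrow> nat" where
  "block_start k i = (if i < k then k - 1 else k)"

lemma block_start_le:
  assumes "k \<le> Suc n" and "i \<le> Suc n" and "i \<noteq> k"
  shows "block_start k i \<le> n"
  using assms by (auto simp: block_start_def)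

text \<open>
  All four maps restrict to the maps of the same kind one dimension lower. The first and the third
  equation hold because the removed vertex lies outside the block, so that block and
  block coordinate are only renumbered.
\<close>

lemma block_maps_coface:
  fixes i k n p :: nat
  assumes "i \<noteq> k" and "k \<le> Suc n" and "i \<le> Suc n"
  defines "i' \<equiv> facet_index p k i" and "k' \<equiv> block_start k i"
  shows "compose {..n + p} (block_coordinate p (Suc n) k) (coface (Suc n + p) i')
       = block_coordinate p n k'"
    and "compose {..n + p} (collapse_block p (Suc n) k) (coface (Suc n + p) i')
       = compose {..n + p} (coface (Suc n) i) (collapse_block p n k')"
    and "compose {..p} (coface (Suc n + p) i') (include_block p k') = include_block p k"
    and "compose {..n} (coface (Suc n + p) i') (skip_block p n k')
       = compose {..n} (skip_block p (Suc n) k) (coface (Suc n) i)"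
  using assms(1-3)
  by (auto simp: compose_def fun_eq_iff block_coordinate_def collapse_block_def
      include_block_def skip_block_def coface_def i'_def k'_def facet_index_def block_start_def)

definition expand :: "'a bisset \<Rightarrow> nat \<Rightarrow> nat \<Rightarrow> nat \<Rightarrow> 'a \<Rightarrow> 'a" where
  "expand X p n k =
     biact X (n + p) p (block_coordinate p n k) (n + p) n (collapse_block p n k)"

definition contract :: "'a bisset \<Rightarrow> nat \<Rightarrow> nat \<Rightarrow> nat \<Rightarrow> 'a \<Rightarrow> 'a" where
  "contract X p n k = biact X p (n + p) (include_block p k) n (n + p) (skip_block p n k)"

lemma biact_in_bisimplices:
  assumes "bisimplicial_set X" and "\<alpha> \<in> delta_hom p p'" and "\<beta> \<in> delta_hom q q'"
    and "x \<in> bisimplices X p' q'"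
  shows "biact X p p' \<alpha> q q' \<beta> x \<in> bisimplices X p q"
  using assms(1)[unfolded bisimplicial_set_def, THEN conjunct1, rule_format, OF assms(2,3)] assms(4)
  by (rule funcset_mem)

lemma biact_compose:
  assumes "bisimplicial_set X"
    and "\<alpha> \<in> delta_hom p p'" and "\<alpha>' \<in> delta_hom p' p''"
    and "\<beta> \<in> delta_hom q q'" and "\<beta>' \<in> delta_hom q' q''"
    and "x \<in> bisimplices X p'' q''"
  shows "biact X p p' \<alpha> q q' \<beta> (biact X p' p'' \<alpha>' q' q'' \<beta>' x)
       = biact X p p'' (compose {..p} \<alpha>' \<alpha>) q q'' (compose {..q} \<beta>' \<beta>) x"
  using assms unfolding bisimplicial_set_def by metis

lemma compose_delta_id_left:
  assumes "\<alpha> \<in> delta_hom m n"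
  shows "compose {..m} (delta_id n) \<alpha> = \<alpha>"
  using assms by (auto simp: delta_hom_def compose_def delta_id_def fun_eq_iff PiE_iff extensional_def)

lemma compose_delta_id_right:
  assumes "\<alpha> \<in> delta_hom m n"
  shows "compose {..m} \<alpha> (delta_id m) = \<alpha>"
  using assms by (auto simp: delta_hom_def compose_def delta_id_def fun_eq_iff PiE_iff extensional_def)

lemma expand_in_diag:
  assumes "bisimplicial_set X" and "k \<le> n" and "x \<in> bisimplices X p n"
  shows "expand X p n k x \<in> bisimplices X (n + p) (n + p)"
  unfolding expand_def using assms by (intro biact_in_bisimplices block_maps_in_delta_hom)

lemma contract_in_row:
  assumes "bisimplicial_set X" and "k \<le> n" and "x \<in> bisimplices X (n + p) (n + p)"
  shows "contract X p n k x \<in> bisimplices X p n"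
  unfolding contract_def using assms by (intro biact_in_bisimplices block_maps_in_delta_hom)

lemma contract_expand:
  assumes X: "bisimplicial_set X" and k: "k \<le> n" and x: "x \<in> bisimplices X p n"
  shows "contract X p n k (expand X p n k x) = x"
proof -
  have "contract X p n k (expand X p n k x) = biact X p p (delta_id p) n n (delta_id n) x"
    unfolding contract_def expand_def
    by (simp add: biact_compose[OF X _ _ _ _ x] block_maps_in_delta_hom k block_sections)
  then show ?thesis
    using X x unfolding bisimplicial_set_def by simp
qed

lemma expand_face:
  assumes X: "bisimplicial_set X" and x: "x \<in> bisimplices X p (Suc n)"
    and i: "i \<noteq> k" "k \<le> Suc n" "i \<le> Suc n"
  shows "face (diag X) (Suc n + p) (facet_index p k i) (expand X p (Suc n) k x)
       = expand X p n (block_start k i) (face (row X p) (Suc n) i x)"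
proof -
  note k' = block_start_le[OF i(2,3,1)]
  note maps = block_maps_in_delta_hom[OF i(2), of p] block_maps_in_delta_hom[OF k', of p]
    delta_id_in_delta_hom[of p] coface_in_delta_hom[of "Suc n" i, simplified]
    coface_in_delta_hom[of "Suc n + p" "facet_index p k i", simplified]
  show ?thesis
    using maps block_maps_coface[OF i, of p] compose_delta_id_left[OF maps(5)]
    by (simp add: face_def diag_def row_def expand_def biact_compose[OF X _ _ _ _ x])
qed

text \<open>
  Although the left-hand side takes a face in the second direction only, it is determined by a face of
  the diagonal: the first coordinate of \<open>contract\<close> factors through the block, and hence through the
  facet as well.
\<close>

lemma face_contract:
  assumes X: "bisimplicial_set X" and x: "x \<in> bisimplices X (Suc n + p) (Suc n + p)"
    and i: "i \<noteq> k" "k \<le> Suc n" "i \<le> Suc n"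
  shows "face (row X p) (Suc n) i (contract X p (Suc n) k x)
       = contract X p n (block_start k i) (face (diag X) (Suc n + p) (facet_index p k i) x)"
proof -
  note k' = block_start_le[OF i(2,3,1)]
  note maps = block_maps_in_delta_hom[OF i(2), of p] block_maps_in_delta_hom[OF k', of p]
    delta_id_in_delta_hom[of p] coface_in_delta_hom[of "Suc n" i, simplified]
    coface_in_delta_hom[of "Suc n + p" "facet_index p k i", simplified]
  show ?thesis
    using maps x block_maps_coface[OF i, of p] compose_delta_id_right[OF maps(3)]
    by (simp add: face_def diag_def row_def contract_def biact_compose[OF X])
qed

lemma bisimplicial_map_expand:
  assumes "bisimplicial_map X Y f" and "k \<le> n" and "x \<in> bisimplices X p n"
  shows "f (n + p) (n + p) (expand X p n k x) = expand Y p n k (f p n x)"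
  using assms block_maps_in_delta_hom[of k n p]
  unfolding bisimplicial_map_def expand_def by blast

lemma bisimplicial_map_contract:
  assumes "bisimplicial_map X Y f" and "k \<le> n" and "x \<in> bisimplices X (n + p) (n + p)"
  shows "f p n (contract X p n k x) = contract Y p n k (f (n + p) (n + p) x)"
  using assms block_maps_in_delta_hom[of k n p]
  unfolding bisimplicial_map_def contract_def by blast

section \<open>Lifting horns of a row through the diagonal\<close>

lemma facet_index_cases:
  assumes "v \<le> n + p" and "v \<notin> {k..k + p}" and "k \<le> n"
  obtains i where "i \<le> n" "i \<noteq> k" "v = facet_index p k i"
proof (cases "v < k")
  case True
  then show ?thesis
    using assms that[of v] by (simp add: facet_index_def)
next
  case False
  then show ?thesis
    using assms that[of "v - p"] by (simp add: facet_index_def)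
qed

theorem theorem1:
  fixes X :: "'a bisset" and Y :: "'b bisset" and f :: "nat \<Rightarrow> nat \<Rightarrow> 'a \<Rightarrow> 'b"
  assumes "bisimplicial_map X Y f"
    and "kan_fibration (diag X) (diag Y) (diag_map f)"
  shows "\<forall>p. kan_fibration (row X p) (row Y p) (row_map f p)"
proof
  fix p
  have X: "bisimplicial_set X" and Y: "bisimplicial_set Y"
    using assms(1) unfolding bisimplicial_map_def by auto
  have "\<exists>z\<in>simplices (row X p) n. (\<forall>i\<le>n. i \<noteq> k \<longrightarrow> face (row X p) n i z = x i)
      \<and> row_map f p n z = y"
    if "n \<ge> 1" and k: "k \<le> n" and y: "y \<in> simplices (row Y p) n"
      and x: "\<forall>i\<le>n. i \<noteq> k \<longrightarrow> x i \<in> simplices (row X p) (n - 1)"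
      and comm: "\<forall>i j. i < j \<and> j \<le> n \<and> i \<noteq> k \<and> j \<noteq> k \<longrightarrow>
           face (row X p) (n - 1) i (x j) = face (row X p) (n - 1) (j - 1) (x i)"
      and fx: "\<forall>i\<le>n. i \<noteq> k \<longrightarrow> face (row Y p) n i y = row_map f p (n - 1) (x i)"
    for n k x y
  proof -
    obtain m where n: "n = Suc m"
      using \<open>n \<ge> 1\<close> by (cases n) auto
    have y: "y \<in> bisimplices Y p (Suc m)"
      using y by (simp add: row_def n)
    have x: "x i \<in> bisimplices X p m" if "i \<le> Suc m" "i \<noteq> k" for i
      using x that by (simp add: row_def n)
    have fx: "face (row Y p) (Suc m) i y = f p m (x i)" if "i \<le> Suc m" "i \<noteq> k" for i
      using fx that by (simp add: row_map_def n)
    have k: "k \<le> Suc m" using k n by simp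
    (* The expanded horn. For v outside the block, i is the image of v under the collapse. *)
    define x' where "x' v = (let i = if v < k then v else v - p
        in expand X p m (block_start k i) (x i))" for v
    have x': "x' (facet_index p k i) = expand X p m (block_start k i) (x i)" if "i \<noteq> k" for i
      using that by (auto simp: x'_def facet_index_def)
    note ks = block_start_le[OF k]
    have "\<exists>z\<in>simplices (diag X) (n + p).
        (\<forall>i\<le>n + p. i \<notin> {k..k + p} \<longrightarrow> face (diag X) (n + p) i z = x' i)
        \<and> diag_map f (n + p) z = expand Y p n k y"
    proof (rule kan_fibration_lifts_consecutive_horn[OF assms(2)])
      show "p < n + p" "k + p \<le> n + p"
        using k n by auto
      show "expand Y p n k y \<in> simplices (diag Y) (n + p)"
        using expand_in_diag[OF Y k y] by (simp add: diag_def n)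
    next
      fix v assume "v \<le> n + p" "v \<notin> {k..k + p}"
      then obtain i where i: "i \<le> Suc m" "i \<noteq> k" and v: "v = facet_index p k i"
        using facet_index_cases k n by metis
      show "x' v \<in> simplices (diag X) (n + p - 1)"
        using expand_in_diag[OF X ks[OF i] x[OF i]] by (simp add: v x' i n diag_def)
      show "face (diag Y) (n + p) v (expand Y p n k y) = diag_map f (n + p - 1) (x' v)"
        using expand_face[OF Y y i(2) k i(1)] fx[OF i]
          bisimplicial_map_expand[OF assms(1) ks[OF i] x[OF i]]
        by (simp add: v x' i n diag_map_def)
    next
      fix u v assume uv: "u < v" "v \<le> n + p" "u \<notin> {k..k + p}" "v \<notin> {k..k + p}"
      obtain i where i: "i \<le> Suc m" "i \<noteq> k" and u: "u = facet_index p k i"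
        using facet_index_cases[of u n p k] uv k n by auto
      obtain j where j: "j \<le> Suc m" "j \<noteq> k" and v: "v = facet_index p k j"
        using facet_index_cases[of v n p k] uv k n by auto
      have ij: "i < j"
        using uv(1) by (auto simp: u v facet_index_def split: if_splits)
      then obtain l where m: "m = Suc l"
        using i j k by (cases m) auto
      (* Removing the vertices over i and j in either order leads to the same block; after the
         removal of the smaller one, j has become j - 1. *)
      have 1: "facet_index p k i = facet_index p (block_start k j) i"
        "v - 1 = facet_index p (block_start k i) (j - 1)"
        "block_start (block_start k j) i = block_start (block_start k i) (j - 1)"
        "i \<noteq> block_start k j" "j - 1 \<noteq> block_start k i"
        using ij i(2) j(2) by (auto simp: v facet_index_def block_start_def)
      have "face (diag X) (m + p) u (x' v)
          = expand X p l (block_start (block_start k j) i) (face (row X p) m i (x j))"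
        using expand_face[OF X _ 1(4), of "x j" p l] x[OF j] ks[OF j] ij j
        by (simp add: m u v 1(1) x')
      also have "\<dots> = expand X p l (block_start (block_start k i) (j - 1))
          (face (row X p) m (j - 1) (x i))"
        using comm ij i j 1(3) n by auto
      also have "\<dots> = face (diag X) (m + p) (v - 1) (x' u)"
        using expand_face[OF X _ 1(5), of "x i" p l] x[OF i] ks[OF i] ij j i
        by (simp add: m u 1(2)[unfolded One_nat_def] x')
      finally show "face (diag X) (n + p - 1) u (x' v) = face (diag X) (n + p - 1) (v - 1) (x' u)"
        by (simp add: n)
    qed
    then obtain z where z: "z \<in> bisimplices X (Suc m + p) (Suc m + p)"
        "f (Suc m + p) (Suc m + p) z = expand Y p (Suc m) k y"
      and zf: "\<And>v. v \<le> Suc m + p \<Longrightarrow> v \<notin> {k..k + p} \<Longrightarrow> face (diag X) (Suc m + p) v z = x' v"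
      by (auto simp: n diag_def diag_map_def)
    show ?thesis
    proof (intro bexI conjI allI impI)
      show "contract X p n k z \<in> simplices (row X p) n"
        using contract_in_row[OF X k z(1)] by (simp add: n row_def)
      show "row_map f p n (contract X p n k z) = y"
        using bisimplicial_map_contract[OF assms(1) k z(1)] contract_expand[OF Y k y] z(2)
        by (simp add: n row_map_def)
      fix i assume "i \<le> n" "i \<noteq> k"
      then have i: "i \<le> Suc m" "i \<noteq> k" by (simp_all add: n)
      have "face (diag X) (Suc m + p) (facet_index p k i) z = x' (facet_index p k i)"
        using i by (intro zf) (auto simp: facet_index_def)
      then show "face (row X p) n i (contract X p n k z) = x i"
        using face_contract[OF X z(1) i(2) k i(1)] contract_expand[OF X ks[OF i] x[OF i]]
        by (simp add: n x' i)
    qed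
  qed
  then show "kan_fibration (row X p) (row Y p) (row_map f p)"
    unfolding kan_fibration_def using simplicial_map_row_map[OF assms(1)] by blast
qed

end
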